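(* Let $d\ge 2$ and let $\mathcal{G}(n)$ be a strongly connected directed graph on $n$ nodes. Suppose that at least one of the following two conditions is satisfied: (i) $d=2$ and $\mathcal{G}(n)$ is a strongly connected directed graph; (ii) $d\geq 2$ and $\mathcal{G}(n)$ is the complete graph. Then the subset of matrices $A\in\mathcal{A}(\mathcal{G}(n))$ that satisfy $\mathcal{F}(A)\neq\tilde{\mathcal{C}}$ has measure zero in $\mathcal{A}(\mathcal{G}(n))$.
   Context: A directed graph $\mathcal{G}(n)=(\mathcal{V}(n),\mathcal{E})$ has nodes $\mathcal{V}(n)=\{1,\dots,n\}$ and edges $\mathcal{E}\subset \mathcal{V}(n)\times\mathcal{V}(n)$. It is strongly connected if there is a directed path between any two nodes. It is the complete graph if $(i,j)\in\mathcal{E}$ for all $i\ne j$. A matrix $A=[a_{ij}]\in\mathbb{R}^{n\times n}$ (not necessarily symmetric) is a weight matrix for $\mathcal{G}(n)$ if all its entries are non-negative and, for all $i\neq j$, $a_{ij}>0$ if and only if $(i,j)\in\mathcal{E}$. It is strictly diagonally dominant if $a_{ii}>\sum_{j\ne i}a_{ij}$ for all $i$. $\mathcal{A}(\mathcal{G}(n))$ denotes the set of all strictly diagonally dominant weight matrices for $\mathcal{G}(n)$. It is an open subset of the Euclidean space whose coordinates are the diagonal entries $a_{ii}$ and the entries $a_{ij}$ with $i\neq j$, $(i,j)\in\mathcal{E}$ (all other entries being zero), and measure zero refers to Lebesgue measure on that space. $\mathbb{S}^{d-1}$ is the Euclidean unit sphere in $\mathbb{R}^d$, and $(\mathbb{S}^{d-1})^n$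 is the set of stacked vectors $x=[x_1^T,\dots,x_n^T]^T\in\mathbb{R}^{nd}$ with each $x_i\in\mathbb{S}^{d-1}$; equivalently $x=\text{vec}(X^T)$, where $X\in\mathbb{R}^{n\times d}$ is the matrix whose $i$-th row is $x_i^T$. For $A\in\mathcal{A}(\mathcal{G}(n))$ the map $f:(\mathbb{S}^{d-1})^n\to(\mathbb{S}^{d-1})^n$ is defined by $f(x)=[f_1(x)^T,\dots,f_n(x)^T]^T$ with $$f_i(x)=\frac{\sum_{j=1}^n a_{ij}x_j}{\left\|\sum_{j=1}^n a_{ij}x_j\right\|_2},$$ which is well defined. $\mathcal{F}(A)=\{x\in(\mathbb{S}^{d-1})^n: f(x)=x\}$ is the set of fixed points of $f$ for the weight matrix $A$. Finally, $$\tilde{\mathcal{C}}=\{x\in(\mathbb{S}^{d-1})^n: x=\text{vec}(X^T),\ \text{rank}(X)=1\},$$ i.e. the set of $x$ for which any two $x_i,x_j$ are equal or antipodal. *)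

theory Defs
  imports "HOL-Analysis.Analysis"
begin

text \<open>
  The nodes of a directed graph are the elements of a finite type \<open>'n\<close>, and the graph is given by
  its edge set. Self-loops are permitted; they play no role in the notions below.
\<close>

definition strongly_connected :: "('n \<times> 'n) set \<Rightarrow> bool" where
  "strongly_connected E \<longleftrightarrow> (\<forall>i j. (i, j) \<in> E\<^sup>*)"

definition complete_graph :: "('n \<times> 'n) set \<Rightarrow> bool" where
  "complete_graph E \<longleftrightarrow> (\<forall>i j. i \<noteq> j \<longrightarrow> (i, j) \<in> E)"

definition weight_matrix :: "('n::finite \<times> 'n) set \<Rightarrow> real^'n^'n \<Rightarrow> bool" where
  "weight_matrix E A \<longleftrightarrow>
     (\<forall>i j. 0 \<le> A $ i $ j) \<and> (\<forall>i j. i \<noteq> j \<longrightarrow> (0 < A $ i $ j \<longleftrightarrow> (i, j) \<in> E))"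

definition strictly_diag_dominant :: "real^'n^'n \<Rightarrow> bool" where
  "strictly_diag_dominant A \<longleftrightarrow> (\<forall>i. (\<Sum>j\<in>UNIV - {i}. A $ i $ j) < A $ i $ i)"

definition dominant_weights :: "('n::finite \<times> 'n) set \<Rightarrow> (real^'n^'n) set" where
  "dominant_weights E = {A. weight_matrix E A \<and> strictly_diag_dominant A}"

text \<open>
  The Euclidean space in which the dominant weight matrices of a graph form an open set has one
  coordinate for each diagonal position and each edge. As this index set depends on the graph, the
  space is rendered as extensional functions on the index set, with the product Lebesgue measure.
  Completing the product of the Borel--Lebesgue measures gives Lebesgue measure, so that a null set
  is any subset of a measurable set of measure zero.
\<close>

definition free_positions :: "('n \<times> 'n) set \<Rightarrow> ('n \<times> 'n) set" where
  "free_positions E = {(i, j). i = j \<or> (i, j) \<in> E}"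

definition coords :: "('n::finite \<times> 'n) set \<Rightarrow> real^'n^'n \<Rightarrow> ('n \<times> 'n \<Rightarrow> real)" where
  "coords E A = (\<lambda>(i, j)\<in>free_positions E. A $ i $ j)"

definition coord_measure :: "('n::finite \<times> 'n) set \<Rightarrow> ('n \<times> 'n \<Rightarrow> real) measure" where
  "coord_measure E = completion (\<Pi>\<^sub>M p\<in>free_positions E. lborel)"

definition measure_zero_in_weights :: "('n::finite \<times> 'n) set \<Rightarrow> (real^'n^'n) set \<Rightarrow> bool" where
  "measure_zero_in_weights E S \<longleftrightarrow>
     S \<subseteq> dominant_weights E \<and> coords E ` S \<in> null_sets (coord_measure E)"

text \<open>
  A stacked vector \<open>x = vec (X\<^sup>T)\<close> is identified with the matrix \<open>X\<close>, whose \<open>i\<close>-th row \<open>X $ i\<close>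
  is the \<open>i\<close>-th block of \<open>x\<close>.
\<close>

definition sphere_product :: "(real^'d^'n) set" where
  "sphere_product = {x. \<forall>i. x $ i \<in> sphere 0 1}"

definition update_map :: "real^'n^'n \<Rightarrow> real^'d^'n \<Rightarrow> real^'d^'n" where
  "update_map A x =
     (\<chi> i. (\<Sum>j\<in>UNIV. A $ i $ j *\<^sub>R x $ j) /\<^sub>R norm (\<Sum>j\<in>UNIV. A $ i $ j *\<^sub>R x $ j))"

definition fixed_points :: "real^'n^'n \<Rightarrow> (real^'d^'n) set" where
  "fixed_points A = {x \<in> sphere_product. update_map A x = x}"

definition consensus_or_antipodal :: "(real^'d^'n) set" where
  "consensus_or_antipodal = {X \<in> sphere_product. rank X = 1}"

end

(* At a fixed point every weighted sum of row s of A against the x_j is a multiple of x_s. If the unit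
   vectors x_j span a space of dimension r >= 2, then in enough rows these equations determine r - 1
   weights each (for d = 2 and r = 2: one weight in every row having a non-aligned out-neighbour)
   from the remaining weights and the x_j. The unit vectors contribute r - 1 parameters for each such
   row, but rotation invariance removes at least one of them. So the exceptional matrices lie in
   finitely many images of hyperplanes under differentiable maps between spaces of equal dimension. *)
theory Submission
  imports Defs
begin

section \<open>Lebesgue measure on vectors as a product measure, and null slices\<close>

lemma measurable_vec_lambda:
  "vec_lambda \<in> measurable (\<Pi>\<^sub>M p\<in>UNIV. lborel) (borel :: (real^'m) measure)"
  by (subst borel_measurable_euclidean_space) (auto simp: Basis_vec_def inner_axis)

text \<open>Lebesgue measure is determined by its values on boxes, and both sides give the product
  of the side lengths. This links \<open>negligible\<close>, which concerns vectors, to the product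
  underlying \<open>coord_measure\<close>.\<close>

lemma lborel_vec_eq_distr_PiM:
  "(lborel :: (real^'m) measure) = distr (\<Pi>\<^sub>M p\<in>UNIV. lborel) borel vec_lambda"
proof (rule lborel_eqI)
  interpret product_sigma_finite "\<lambda>_::'m. lborel :: real measure" ..
  fix l u :: "real^'m" assume le: "\<And>b. b \<in> Basis \<Longrightarrow> l \<bullet> b \<le> u \<bullet> b"
  have le': "l $ i \<le> u $ i" for i
    using le[of "axis i 1"] by (simp add: inner_axis axis_in_Basis_iff)
  have "vec_lambda -` box l u \<inter> space (\<Pi>\<^sub>M p\<in>(UNIV::'m set). lborel)
      = (\<Pi>\<^sub>E p\<in>UNIV. {l $ p <..< u $ p})"
    by (auto simp: mem_box_cart PiE_def space_PiM extensional_def Pi_iff)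
  then have "emeasure (distr (\<Pi>\<^sub>M p\<in>(UNIV::'m set). lborel) borel vec_lambda) (box l u)
      = (\<Prod>p\<in>UNIV. emeasure lborel {l $ p <..< u $ p})"
    by (simp add: emeasure_distr[OF measurable_vec_lambda] emeasure_PiM)
  also have "\<dots> = (\<Prod>p\<in>UNIV. ennreal ((u - l) $ p))"
    using le' by simp
  also have "\<dots> = (\<Prod>b\<in>Basis. ennreal ((u - l) \<bullet> b))"
    unfolding Basis_vec_def Basis_real_def
    by (subst prod.UNION_disjoint) (auto simp: axis_eq_axis inner_axis)
  finally show "emeasure (distr (\<Pi>\<^sub>M p\<in>(UNIV::'m set). lborel) borel vec_lambda) (box l u)
      = (\<Prod>b\<in>Basis. (u - l) \<bullet> b)"
    using le by (subst (asm) prod_ennreal) (auto simp: inner_diff_left)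
qed simp

text \<open>By Fubini, almost every slice of a Borel null superset of \<open>N\<close> is null; one such slice covers \<open>B\<close>.\<close>
lemma null_sets_completion_slice:
  fixes N :: "(real^'m) set" and I :: "'m set"
  assumes N: "negligible N"
    and B: "B \<subseteq> space (\<Pi>\<^sub>M p\<in>I. lborel)"
    and cyl: "\<And>g T. g \<in> B \<Longrightarrow> (\<And>p. p \<in> I \<Longrightarrow> T $ p = g p) \<Longrightarrow> T \<in> N"
  shows "B \<in> null_sets (completion (\<Pi>\<^sub>M p\<in>I. lborel))"
proof -
  interpret product_sigma_finite "\<lambda>_::'m. lborel :: real measure" ..
  let ?P = "\<lambda>J::'m set. (\<Pi>\<^sub>M p\<in>J. lborel) :: ('m \<Rightarrow> real) measure"
  interpret I: finite_product_sigma_finite "\<lambda>_. lborel" I by standard simp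
  interpret J: finite_product_sigma_finite "\<lambda>_. lborel" "- I" by standard simp
  interpret JI: pair_sigma_finite "?P (- I)" "?P I" ..
  obtain N' where N': "N \<subseteq> N'" "N' \<in> null_sets lborel"
    using N by (auto simp: negligible_iff_null_sets null_sets_completion_iff2)
  have mg: "merge (- I) I \<in> measurable (?P (- I) \<Otimes>\<^sub>M ?P I) (?P UNIV)"
    using measurable_merge[of "- I" I "\<lambda>_. lborel"] by simp
  have mrg: "distr (?P (- I) \<Otimes>\<^sub>M ?P I) (?P UNIV) (merge (- I) I) = ?P UNIV"
    using distr_merge[of "- I" I] by simp
  have "AE T in lborel. T \<notin> N'"
    using N'(2) by (rule AE_not_in)
  then have "AE T in distr (?P UNIV) borel vec_lambda. T \<notin> N'"
    by (simp only: lborel_vec_eq_distr_PiM)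
  then have "AE g in ?P UNIV. vec_lambda g \<notin> N'"
    by (rule AE_distrD[OF measurable_vec_lambda])
  then have "AE g in distr (?P (- I) \<Otimes>\<^sub>M ?P I) (?P UNIV) (merge (- I) I). vec_lambda g \<notin> N'"
    by (simp only: mrg)
  then have "AE z in ?P (- I) \<Otimes>\<^sub>M ?P I. vec_lambda (merge (- I) I z) \<notin> N'"
    by (rule AE_distrD[OF mg])
  then have ae: "AE y in ?P (- I). AE g in ?P I. vec_lambda (merge (- I) I (y, g)) \<notin> N'"
    by (rule JI.AE_pair)
  \<comment> \<open>The product over \<open>- I\<close> has non-zero total measure, also when
    \<open>- I\<close> is empty, so a property that holds almost everywhere has a witness
    \<open>y\<close>.\<close>
  have "emeasure (?P (- I)) (space (?P (- I))) \<noteq> 0"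
    unfolding space_PiM by (subst emeasure_PiM) auto
  then have "ae_filter (?P (- I)) \<noteq> bot"
    by (simp add: ae_filter_eq_bot_iff)
  with ae obtain y where y: "AE g in ?P I. vec_lambda (merge (- I) I (y, g)) \<notin> N'"
    using eventually_happens' by blast
  then obtain Z where Z: "{g \<in> space (?P I). \<not> vec_lambda (merge (- I) I (y, g)) \<notin> N'} \<subseteq> Z"
      "emeasure (?P I) Z = 0" "Z \<in> sets (?P I)"
    by (rule AE_E)
  have "B \<subseteq> Z"
  proof
    fix g assume g: "g \<in> B"
    \<comment> \<open>Filling the positions outside \<open>I\<close> from \<open>y\<close> gives a
      point of the cylinder over \<open>g\<close>.\<close>
    have "vec_lambda (merge (- I) I (y, g)) \<in> N"
      by (rule cyl[OF g]) (simp add: merge_def)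
    then show "g \<in> Z"
      using g B N'(1) Z(1) by blast
  qed
  with Z(2,3) show ?thesis
    unfolding null_sets_completion_iff2 by (auto simp: null_sets_def)
qed

section \<open>Differentiability of determinants and of vector-valued maps\<close>

lemma differentiable_prod:
  fixes f :: "'i \<Rightarrow> 'a::real_normed_vector \<Rightarrow> 'b::real_normed_field"
  assumes "\<And>i. i \<in> I \<Longrightarrow> f i differentiable (at x within S)"
  shows "(\<lambda>x. \<Prod>i\<in>I. f i x) differentiable (at x within S)"
proof -
  obtain f' where "\<And>i. i \<in> I \<Longrightarrow> (f i has_derivative f' i) (at x within S)"
    using assms unfolding differentiable_def by metis
  then show ?thesis
    unfolding differentiable_def by (blast intro: has_derivative_prod)
qed

lemma differentiable_det:
  fixes M :: "'a::real_normed_vector \<Rightarrow> real^'d^'d"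
  assumes "\<And>i j. (\<lambda>x. M x $ i $ j) differentiable (at x within S)"
  shows "(\<lambda>x. det (M x)) differentiable (at x within S)"
  unfolding det_def using assms
  by (intro differentiable_sum ballI differentiable_mult differentiable_prod differentiable_const)
    (auto simp: finite_permutations)

lemma differentiable_vec_componentwise:
  fixes f :: "'a::real_normed_vector \<Rightarrow> real^'m"
  assumes "\<And>i. (\<lambda>x. f x $ i) differentiable (at x within S)"
  shows "f differentiable (at x within S)"
proof -
  obtain f' where "\<And>i. ((\<lambda>x. f x $ i) has_derivative f' i) (at x within S)"
    using assms unfolding differentiable_def by metis
  then have "(f has_derivative (\<lambda>h. \<chi> i. f' i h)) (at x within S)"
    by (subst has_derivative_componentwise_within) (auto simp: Basis_vec_def inner_axis)
  then show ?thesis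
    unfolding differentiable_def by blast
qed

lemma differentiable_if [simp]:
  assumes "f differentiable F" "g differentiable F"
  shows "(\<lambda>x. if b then f x else g x) differentiable F"
  using assms by (cases b) auto

lemma differentiable_vec_nth [simp]:
  "(\<lambda>x. x $ i) differentiable (at (x :: real^'m) within S)"
  by (rule bounded_linear_imp_differentiable) (rule bounded_linear_vec_nth)

section \<open>Parametrisation of weight matrices by configurations of unit vectors\<close>

text \<open>
  For \<open>s \<in> range \<rho>\<close> and \<open>k \<in> R - {\<kappa> s}\<close>, the slot \<open>(s, \<iota> s k)\<close> of \<open>T\<close> does not
  hold a weight but the \<open>k\<close>-th coordinate of \<open>x\<^sub>s / x\<^sub>s $ \<kappa> s\<close>; all other slots hold weights.
  The remaining nodes copy the unit vector of their representative \<open>\<rho> i\<close> up to sign.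
\<close>
locale slots =
  fixes E :: "('n::finite \<times> 'n) set"
    and R :: "'d::finite set" and \<kappa> :: "'n \<Rightarrow> 'd" and \<iota> :: "'n \<Rightarrow> 'd \<Rightarrow> 'n"
    and \<rho> :: "'n \<Rightarrow> 'n" and \<sigma> :: "'n \<Rightarrow> bool"
begin

text \<open>An affine chart of projective space: a line is represented by its vector whose
  coordinate \<open>\<kappa> s\<close> is 1.\<close>

definition chart :: "real^('n \<times> 'n) \<Rightarrow> 'n \<Rightarrow> real^'d" where
  "chart T s = (\<chi> k. if k = \<kappa> s then 1 else if k \<in> R then T $ (s, \<iota> s k) else 0)"

text \<open>Normalising a chart vector gives the unit vector up to sign; \<open>\<sigma>\<close>
  supplies the sign.\<close>

definition config :: "real^('n \<times> 'n) \<Rightarrow> 'n \<Rightarrow> real^'d" where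
  "config T i = (if \<sigma> i then 1 else - 1) *\<^sub>R sgn (chart T (\<rho> i))"

text \<open>The rows are the vectors that multiply the unknowns in the equation of row
  \<open>s\<close>. The axes outside \<open>R\<close> pad them to a square matrix when the span of
  the configuration is not the whole space.\<close>

definition system :: "('n \<Rightarrow> real^'d) \<Rightarrow> 'n \<Rightarrow> real^'d^'d" where
  "system x s = (\<chi> k. if k = \<kappa> s then x s else if k \<in> R then x (\<iota> s k) else axis k 1)"

definition known :: "'n \<Rightarrow> 'n set" where
  "known s = {j. (s, j) \<in> E \<and> j \<noteq> s \<and> j \<notin> \<iota> s ` (R - {\<kappa> s})}"

text \<open>The right-hand side once the weights still stored in \<open>T\<close> are moved across.
  The diagonal weight is absent: it merges with the unknown multiplier of
  \<open>x s\<close>.\<close>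

definition residual :: "real^('n \<times> 'n) \<Rightarrow> 'n \<Rightarrow> real^'d" where
  "residual T s = - (\<Sum>j\<in>known s. T $ (s, j) *\<^sub>R config T j)"

definition slot :: "'n \<times> 'n \<Rightarrow> bool" where
  "slot p \<longleftrightarrow> fst p \<in> range \<rho> \<and> snd p \<in> \<iota> (fst p) ` (R - {\<kappa> (fst p)})"

definition slot_index :: "'n \<times> 'n \<Rightarrow> 'd" where
  "slot_index p = inv_into (R - {\<kappa> (fst p)}) (\<iota> (fst p)) (snd p)"

text \<open>Cramer's rule recovers the weights that the slots have displaced.\<close>
definition weights :: "real^('n \<times> 'n) \<Rightarrow> real^('n \<times> 'n)" where
  "weights T = (\<chi> p. if slot p
     then det (\<chi> a b. if b = slot_index p then residual T (fst p) $ a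
                      else system (config T) (fst p) $ b $ a) / det (system (config T) (fst p))
     else T $ p)"

definition regular :: "(real^('n \<times> 'n)) set" where
  "regular = {T. \<forall>s\<in>range \<rho>. det (system (config T) s) \<noteq> 0}"

lemma chart_nonzero: "chart T s \<noteq> 0"
proof
  assume "chart T s = 0"
  then have "chart T s $ \<kappa> s = 0" by simp
  then show False by (simp add: chart_def)
qed

lemma differentiable_chart: "(\<lambda>T. chart T s) differentiable (at T within S)"
  by (rule differentiable_vec_componentwise) (auto simp: chart_def)

text \<open>Normalisation is differentiable because a chart vector is never 0.\<close>

lemma differentiable_config [simp]: "(\<lambda>T. config T i $ k) differentiable (at T within S)"
proof -
  have n: "(\<lambda>T. norm (chart T s)) differentiable (at T within S)" for s
    by (rule differentiable_compose[OF differentiable_norm_at differentiable_chart])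
      (rule chart_nonzero)
  have c: "(\<lambda>T. chart T s $ k) differentiable (at T within S)" for s
    by (auto simp: chart_def)
  have "(\<lambda>T. (if \<sigma> i then 1 else - 1) * (chart T (\<rho> i) $ k / norm (chart T (\<rho> i))))
      differentiable (at T within S)"
    by (intro differentiable_mult differentiable_divide n c differentiable_const)
      (simp add: chart_nonzero)
  then show ?thesis
    by (simp only: config_def sgn_div_norm divide_inverse mult.commute vector_scaleR_component
        real_scaleR_def)
qed

lemma differentiable_system [simp]:
  "(\<lambda>T. system (config T) s $ a $ b) differentiable (at T within S)"
  by (simp add: system_def if_distrib[of "\<lambda>v. v $ b"])

lemma differentiable_residual [simp]: "(\<lambda>T. residual T s $ k) differentiable (at T within S)"
proof -
  have "(\<lambda>T. - (\<Sum>j\<in>known s. T $ (s, j) * config T j $ k)) differentiable (at T within S)"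
    by (intro differentiable_minus differentiable_sum ballI differentiable_mult) auto
  then show ?thesis
    by (simp add: residual_def)
qed

text \<open>Each displaced weight is a quotient of determinants whose denominator does not vanish on
  \<open>regular\<close>.\<close>

lemma weights_differentiable_on: "weights differentiable_on regular"
  unfolding differentiable_on_def
proof (intro ballI differentiable_vec_componentwise)
  fix T p assume T: "T \<in> regular"
  show "(\<lambda>T. weights T $ p) differentiable (at T within regular)"
  proof (cases "slot p")
    case True
    then have "det (system (config T) (fst p)) \<noteq> 0"
      using T by (auto simp: regular_def slot_def)
    then have "(\<lambda>T. det (\<chi> a b. if b = slot_index p then residual T (fst p) $ a
        else system (config T) (fst p) $ b $ a) / det (system (config T) (fst p)))
      differentiable (at T within regular)"
      by (intro differentiable_divide differentiable_det) auto
    with True show ?thesis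
      by (simp add: weights_def)
  qed (simp add: weights_def)
qed

text \<open>A differentiable map of a space to itself sends a piece of a hyperplane to a negligible
  set. For a slot \<open>p\<close>, the equation \<open>T $ p = 0\<close> is what a rotation of the
  configuration can enforce.\<close>

lemma negligible_weights_gauge:
  "negligible (weights ` {T \<in> regular. T $ p = 0})"
proof (rule negligible_differentiable_image_negligible)
  have "negligible {T :: real^('n \<times> 'n). axis p 1 \<bullet> T = 0}"
    by (rule negligible_hyperplane) simp
  then show "negligible {T \<in> regular. T $ p = 0}"
    by (rule negligible_subset) (auto simp: inner_axis')
  show "weights differentiable_on {T \<in> regular. T $ p = 0}"
    by (rule differentiable_on_subset[OF weights_differentiable_on]) auto
qed simp

text \<open>Put the chart coordinates of \<open>x\<close> in the slots. The equation of row
  \<open>s\<close> is then a nonsingular linear system for the displaced weights, so Cramer's rule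
  returns them. Entries of \<open>T0\<close> off the graph are arbitrary, since
  \<open>weights\<close> copies them.\<close>

lemma weights_cover:
  fixes A :: "real^'n^'n"
  assumes eq: "\<And>s. s \<in> range \<rho> \<Longrightarrow> (\<Sum>j\<in>UNIV. A $ s $ j *\<^sub>R x j) = lam s *\<^sub>R x s"
    and A: "\<And>i j. i \<noteq> j \<Longrightarrow> (i, j) \<notin> E \<Longrightarrow> A $ i $ j = 0"
    and unit: "\<And>i. norm (x i) = 1"
    and supp: "\<And>i k. k \<notin> R \<Longrightarrow> x i $ k = 0"
    and rep: "\<And>i. x i = (if \<sigma> i then 1 else - 1) *\<^sub>R (sgn (x (\<rho> i) $ \<kappa> (\<rho> i)) *\<^sub>R x (\<rho> i))"
    and \<kappa>: "\<And>s. s \<in> range \<rho> \<Longrightarrow> \<kappa> s \<in> R \<and> x s $ \<kappa> s \<noteq> 0"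
    and inj: "\<And>s. s \<in> range \<rho> \<Longrightarrow> inj_on (\<iota> s) (R - {\<kappa> s})"
    and \<iota>: "\<And>s k. s \<in> range \<rho> \<Longrightarrow> k \<in> R - {\<kappa> s} \<Longrightarrow> \<iota> s k \<noteq> s \<and> (s, \<iota> s k) \<in> E"
    and det: "\<And>s. s \<in> range \<rho> \<Longrightarrow> det (system x s) \<noteq> 0"
    and T0: "\<And>i j. i = j \<or> (i, j) \<in> E \<Longrightarrow> T0 $ (i, j) = A $ i $ j"
    and s0: "s0 \<in> range \<rho>" and k1: "k1 \<in> R - {\<kappa> s0}" and gauge: "x s0 $ k1 = 0"
  shows "T0 \<in> weights ` {T \<in> regular. T $ (s0, \<iota> s0 k1) = 0}"
proof -
  define T :: "real^('n \<times> 'n)" where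
    "T = (\<chi> p. if slot p then x (fst p) $ slot_index p / x (fst p) $ \<kappa> (fst p) else T0 $ p)"
  have idx: "slot (s, \<iota> s k)" "slot_index (s, \<iota> s k) = k" if "s \<in> range \<rho>" "k \<in> R - {\<kappa> s}" for s k
    using that inj[OF that(1)] by (auto simp: slot_def slot_index_def)
  have Tslot: "T $ (s, \<iota> s k) = x s $ k / x s $ \<kappa> s" if "s \<in> range \<rho>" "k \<in> R - {\<kappa> s}" for s k
    using idx[OF that] by (simp add: T_def)
  have chart: "chart T s = (1 / x s $ \<kappa> s) *\<^sub>R x s" if "s \<in> range \<rho>" for s
    using \<kappa>[OF that] Tslot[OF that] supp by (auto simp: chart_def vec_eq_iff)
  have config: "config T = x"
  proof
    fix i
    \<comment> \<open>Dividing by the coordinate \<open>\<kappa> (\<rho> i)\<close> loses its sign,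
      hence the factor that also appears in \<open>rep\<close>.\<close>
    have "sgn (chart T (\<rho> i)) = sgn (x (\<rho> i) $ \<kappa> (\<rho> i)) *\<^sub>R x (\<rho> i)"
      using unit[of "\<rho> i"] by (simp add: chart sgn_scaleR sgn_div_norm[of "x (\<rho> i)"])
    then show "config T i = x i"
      by (simp only: config_def rep[symmetric])
  qed
  have reg: "T \<in> regular"
    using det by (simp add: regular_def config)
  have T_gauge: "T $ (s0, \<iota> s0 k1) = 0"
    using Tslot[OF s0 k1] gauge by simp
  have "weights T $ p = T0 $ p" for p
  proof (cases "slot p")
    case False
    then show ?thesis by (simp add: weights_def T_def)
  next
    case True
    obtain s j where p: "p = (s, j)" by fastforce
    from True obtain k where s: "s \<in> range \<rho>" and k: "k \<in> R - {\<kappa> s}" and j: "j = \<iota> s k"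
      by (auto simp: slot_def p)
    let ?J = "\<iota> s ` (R - {\<kappa> s})"
    \<comment> \<open>The expected solution. The entry at \<open>\<kappa> s\<close> combines the
      diagonal weight with the multiplier \<open>lam s\<close>, so \<open>lam s\<close> need not be
      a parameter; the padding rows get coefficient 0.\<close>
    define c :: "real^'d" where
      "c = (\<chi> k. if k = \<kappa> s then A $ s $ s - lam s else if k \<in> R then A $ s $ \<iota> s k else 0)"
    have known_T: "T $ (s, j) = A $ s $ j" if "j \<in> known s" for j
      using that T0[of s j] by (simp add: T_def slot_def known_def)
    have known: "residual T s = - (\<Sum>j\<in>known s. A $ s $ j *\<^sub>R x j)"
      unfolding residual_def config by (simp add: known_T)
    have split: "(\<Sum>j\<in>UNIV. A $ s $ j *\<^sub>R x j)
        = A $ s $ s *\<^sub>R x s + (\<Sum>j\<in>?J. A $ s $ j *\<^sub>R x j) + (\<Sum>j\<in>known s. A $ s $ j *\<^sub>R x j)"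
    proof -
      have "s \<notin> ?J"
      proof
        assume "s \<in> ?J"
        then obtain k where "s = \<iota> s k" "k \<in> R - {\<kappa> s}" ..
        then show False using \<iota>[OF s, of k] by metis
      qed
      then have sub: "?J \<inter> known s = {}" "s \<notin> ?J \<union> known s"
        unfolding known_def by auto
      have "(\<Sum>j\<in>UNIV. A $ s $ j *\<^sub>R x j) = (\<Sum>j\<in>insert s (?J \<union> known s). A $ s $ j *\<^sub>R x j)"
      proof (rule sum.mono_neutral_right)
        show "\<forall>j\<in>UNIV - insert s (?J \<union> known s). A $ s $ j *\<^sub>R x j = 0"
        proof
          fix j assume "j \<in> UNIV - insert s (?J \<union> known s)"
          then have "s \<noteq> j" "(s, j) \<notin> E" by (auto simp: known_def)
          then show "A $ s $ j *\<^sub>R x j = 0" by (simp add: A)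
        qed
      qed auto
      also have "\<dots> = A $ s $ s *\<^sub>R x s + ((\<Sum>j\<in>?J. A $ s $ j *\<^sub>R x j) + (\<Sum>j\<in>known s. A $ s $ j *\<^sub>R x j))"
        using sub by (subst sum.insert) (auto simp: sum.union_disjoint)
      finally show ?thesis by simp
    qed
    have "(\<Sum>k\<in>UNIV. c $ k *\<^sub>R system x s $ k) = (\<Sum>k\<in>insert (\<kappa> s) (R - {\<kappa> s}). c $ k *\<^sub>R system x s $ k)"
      by (rule sum.mono_neutral_right) (auto simp: c_def)
    also have "\<dots> = (A $ s $ s - lam s) *\<^sub>R x s + (\<Sum>k\<in>R - {\<kappa> s}. A $ s $ \<iota> s k *\<^sub>R x (\<iota> s k))"
      by (subst sum.insert) (auto simp: c_def system_def intro!: sum.cong)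
    also have "(\<Sum>k\<in>R - {\<kappa> s}. A $ s $ \<iota> s k *\<^sub>R x (\<iota> s k)) = (\<Sum>j\<in>?J. A $ s $ j *\<^sub>R x j)"
      using inj[OF s] by (simp add: sum.reindex)
    also have "(A $ s $ s - lam s) *\<^sub>R x s + \<dots> = residual T s"
      using split eq[OF s] by (simp add: known algebra_simps)
    finally have comb: "(\<Sum>k\<in>UNIV. c $ k *\<^sub>R system x s $ k) = residual T s" .
    \<comment> \<open>A combination of rows is the transposed matrix applied to the coefficients,
      the form that Cramer's rule expects.\<close>
    have "transpose (system x s) *v c = residual T s"
      unfolding comb[symmetric]
      by (simp add: vec_eq_iff matrix_vector_mult_def transpose_def mult.commute)
    then have c_eq: "c = (\<chi> k. det (\<chi> a b. if b = k then residual T s $ a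
        else transpose (system x s) $ a $ b) / det (transpose (system x s)))"
      using det[OF s] by (subst cramer[symmetric]) (simp_all only: det_transpose not_False_eq_True)
    have "c $ k = det (\<chi> a b. if b = k then residual T s $ a
        else system x s $ b $ a) / det (system x s)"
      by (subst c_eq) (simp only: vec_lambda_beta det_transpose, simp only: transpose_def vec_lambda_beta)
    also have "\<dots> = weights T $ p"
      using True idx[OF s k] by (simp only: weights_def p j config vec_lambda_beta fst_conv if_True)
    finally have "weights T $ p = c $ k" ..
    also have "\<dots> = T0 $ p"
      using k \<iota>[OF s k] T0[of s j] unfolding p c_def vec_lambda_beta j by auto
    finally show ?thesis .
  qed
  then have "T0 = weights T"
    by (simp add: vec_eq_iff)
  moreover have "T \<in> {T \<in> regular. T $ (s0, \<iota> s0 k1) = 0}"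
    using reg T_gauge by simp
  ultimately show ?thesis by (rule image_eqI)
qed

end

section \<open>Aligned unit vectors, rank and fixed points\<close>

lemma unit_in_span_singleton:
  fixes u v :: "'a::real_normed_vector"
  assumes "norm u = 1" "norm v = 1" "v \<in> span {u}"
  shows "v = u \<or> v = - u"
proof -
  obtain c where c: "v = c *\<^sub>R u"
    using assms(3) by (auto simp: span_singleton)
  with assms have "\<bar>c\<bar> = 1" by simp
  then have "c = 1 \<or> c = - 1" by arith
  with c show ?thesis by auto
qed

lemma rank_eq_dim_range:
  fixes X :: "real^'d^'n"
  shows "rank X = dim (range (($) X))"
proof -
  have "rows X = range (($) X)"
    by (auto simp: rows_def row_def vec_nth_inverse)
  then show ?thesis by (simp add: row_rank_def)
qed

lemma dim_unit_vectors_le_1: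
  fixes x :: "'n \<Rightarrow> 'a::euclidean_space"
  assumes unit: "\<And>i. norm (x i) = 1" and dim: "dim (range x) \<le> 1"
  shows "x j = x i \<or> x j = - x i"
proof (rule unit_in_span_singleton[OF unit unit], rule ccontr)
  assume nin: "x j \<notin> span {x i}"
  have nz: "x i \<noteq> 0" using unit[of i] by auto
  then have "independent {x j, x i}"
    using nin by (simp add: independent_insert)
  then have "card {x j, x i} \<le> dim (range x)"
    by (intro independent_card_le_dim) auto
  moreover have "x j \<noteq> x i"
    using nin by (auto simp: span_base)
  ultimately show False using dim by simp
qed

lemma dominant_weightsD:
  assumes "A \<in> dominant_weights E"
  shows "\<And>i j. 0 \<le> A $ i $ j" "\<And>i j. i \<noteq> j \<Longrightarrow> (i, j) \<notin> E \<Longrightarrow> A $ i $ j = 0"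
    "\<And>i. (\<Sum>j\<in>UNIV - {i}. A $ i $ j) < A $ i $ i"
proof -
  show nonneg: "0 \<le> A $ i $ j" for i j
    using assms by (simp add: dominant_weights_def weight_matrix_def)
  show "A $ i $ j = 0" if "i \<noteq> j" "(i, j) \<notin> E" for i j
  proof -
    have "\<not> 0 < A $ i $ j"
      using assms that by (simp add: dominant_weights_def weight_matrix_def)
    with nonneg[of i j] show ?thesis by simp
  qed
  show "(\<Sum>j\<in>UNIV - {i}. A $ i $ j) < A $ i $ i" for i
    using assms by (simp add: dominant_weights_def strictly_diag_dominant_def)
qed

lemma fixed_points_iff:
  assumes "x \<in> sphere_product"
  shows "x \<in> fixed_points A \<longleftrightarrow> (\<forall>i. update_map A x $ i = x $ i)"
  using assms by (auto simp: fixed_points_def vec_eq_iff)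

text \<open>Here each weighted sum is the vector of its row times a signed sum \<open>m\<close> of
  the weights, and strict diagonal dominance makes \<open>m\<close> positive. Hence an exceptional
  matrix must have a fixed point outside \<open>consensus_or_antipodal\<close>.\<close>

lemma consensus_subset_fixed_points:
  assumes A: "A \<in> dominant_weights E"
  shows "consensus_or_antipodal \<subseteq> (fixed_points A :: (real^'d^'n) set)"
proof
  fix X :: "real^'d^'n" assume X: "X \<in> consensus_or_antipodal"
  then have sp: "X \<in> sphere_product" and unit: "\<And>i. norm (X $ i) = 1"
    by (auto simp: consensus_or_antipodal_def sphere_product_def)
  have "dim (range (($) X)) \<le> 1"
    using X by (simp add: consensus_or_antipodal_def rank_eq_dim_range)
  then have par: "X $ j = X $ i \<or> X $ j = - X $ i" for i j
    using dim_unit_vectors_le_1[of "($) X"] unit by blast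
  have "update_map A X $ i = X $ i" for i
  proof -
    define c where "c j = (if X $ j = X $ i then 1 else - 1 :: real)" for j
    have c: "X $ j = c j *\<^sub>R X $ i" for j
      using par[of j i] by (auto simp: c_def)
    define m where "m = (\<Sum>j\<in>UNIV. A $ i $ j * c j)"
    have sum: "(\<Sum>j\<in>UNIV. A $ i $ j *\<^sub>R X $ j) = m *\<^sub>R X $ i"
      unfolding m_def scaleR_left.sum by (rule sum.cong) (simp_all flip: scaleR_scaleR add: c[symmetric])
    have "m = A $ i $ i + (\<Sum>j\<in>UNIV - {i}. A $ i $ j * c j)"
      unfolding m_def by (subst sum.remove[of _ i]) (auto simp: c_def)
    moreover have "- (\<Sum>j\<in>UNIV - {i}. A $ i $ j) \<le> (\<Sum>j\<in>UNIV - {i}. A $ i $ j * c j)"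
      unfolding sum_negf[symmetric]
      by (rule sum_mono) (use dominant_weightsD(1)[OF A] in \<open>auto simp: c_def\<close>)
    ultimately have "m > 0"
      using dominant_weightsD(3)[OF A, of i] by linarith
    then show ?thesis
      by (simp add: update_map_def sum unit)
  qed
  with sp show "X \<in> fixed_points A"
    by (simp add: fixed_points_iff)
qed

lemma fixed_points_row:
  assumes "x \<in> fixed_points A"
  shows "(\<Sum>j\<in>UNIV. A $ i $ j *\<^sub>R x $ j) = norm (\<Sum>j\<in>UNIV. A $ i $ j *\<^sub>R x $ j) *\<^sub>R x $ i"
proof -
  let ?w = "\<Sum>j\<in>UNIV. A $ i $ j *\<^sub>R x $ j"
  have "x $ i = ?w /\<^sub>R norm ?w"
    using assms by (auto simp: fixed_points_def update_map_def vec_eq_iff)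
  then show ?thesis
    \<comment> \<open>If \<open>?w\<close> is 0 both sides vanish; otherwise the division by its
      norm is undone.\<close>
    by (cases "?w = 0") simp_all
qed

section \<open>Adapted coordinates and bases among out-neighbours\<close>

text \<open>Take inner products with an orthonormal basis of \<open>V\<close> containing
  \<open>u\<close>, indexed by coordinates. This is the rotation that places a chosen unit vector on
  an axis.\<close>

lemma isometric_coordinates:
  fixes V :: "(real^'d) set"
  assumes V: "subspace V" and u: "u \<in> V" "norm u = 1"
  obtains g :: "real^'d \<Rightarrow> real^'d" and R k0 where
    "linear g" "k0 \<in> R" "card R = dim V" "g u = axis k0 1"
    "\<And>v. v \<in> V \<Longrightarrow> norm (g v) = norm v"
    "\<And>v k. k \<notin> R \<Longrightarrow> g v $ k = 0"
    "\<And>k. k \<in> R \<Longrightarrow> axis k 1 \<in> g ` V"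
proof -
  \<comment> \<open>Adding \<open>u\<close> to an orthonormal basis of its complement in
    \<open>V\<close> gives one of \<open>V\<close>.\<close>
  have "subspace {v \<in> V. u \<bullet> v = 0}"
    using V by (auto simp: subspace_def inner_add_right)
  then obtain B where B: "B \<subseteq> {v \<in> V. u \<bullet> v = 0}" "pairwise orthogonal B"
      "\<And>b. b \<in> B \<Longrightarrow> norm b = 1" "span B = {v \<in> V. u \<bullet> v = 0}"
    by (rule orthonormal_basis_subspace) blast
  define C where "C = insert u B"
  have orth: "pairwise orthogonal C"
    unfolding C_def using B by (intro pairwise_orthogonal_insert) (auto simp: orthogonal_def)
  have unit: "norm c = 1" if "c \<in> C" for c
    using that B u by (auto simp: C_def)
  have ind: "independent C"
    using orth unit[of 0] by (intro pairwise_orthogonal_independent) auto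
  then have fin: "finite C" by (rule independent_imp_finite)
  have CV: "C \<subseteq> V" using B u by (auto simp: C_def)
  have VC: "v \<in> span C" if "v \<in> V" for v
  proof -
    have "v - (u \<bullet> v) *\<^sub>R u \<in> {v \<in> V. u \<bullet> v = 0}"
      using that V u by (auto simp: subspace_diff subspace_scale inner_diff_right dot_square_norm)
    then have "v - (u \<bullet> v) *\<^sub>R u \<in> span C"
      using span_mono[of B C] by (auto simp: C_def B(4)[symmetric])
    moreover have "(u \<bullet> v) *\<^sub>R u \<in> span C"
      by (intro span_scale span_base) (simp add: C_def)
    ultimately have "(v - (u \<bullet> v) *\<^sub>R u) + (u \<bullet> v) *\<^sub>R u \<in> span C"
      by (rule span_add)
    then show ?thesis by simp
  qed
  have dimV: "card C = dim V"
    using CV VC ind by (intro basis_card_eq_dim) auto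
  have ip: "c \<bullet> c' = (if c = c' then 1 else 0)" if "c \<in> C" "c' \<in> C" for c c'
    using that orth unit by (auto simp: pairwise_def orthogonal_def dot_square_norm)
  have "card C \<le> card (UNIV :: 'd set)"
    using independent_bound[OF ind] by simp
  \<comment> \<open>The basis injects into the coordinate indices; its image serves as
    \<open>R\<close>.\<close>
  then obtain b where b: "inj_on b C" "b ` C \<subseteq> (UNIV :: 'd set)"
    using fin by (metis card_le_inj finite)
  define h where "h = inv_into C b"
  define g where "g v = (\<chi> k. if k \<in> b ` C then v \<bullet> h k else 0)" for v :: "real^'d"
  have hb: "h (b c) = c" if "c \<in> C" for c
    using that b by (simp add: h_def)
  have gC: "g c = axis (b c) 1" if "c \<in> C" for c
  proof -
    have "g c $ k = axis (b c) 1 $ k" for k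
      using that b by (auto simp: g_def axis_def hb ip inj_on_eq_iff)
    then show ?thesis by (simp add: vec_eq_iff)
  qed
  show ?thesis
  proof
    show "linear g"
      by (rule linearI) (auto simp: g_def vec_eq_iff inner_add_left)
    show "b u \<in> b ` C" by (simp add: C_def)
    show "card (b ` C) = dim V"
      using b dimV by (simp add: card_image)
    show "g u = axis (b u) 1" by (rule gC) (simp add: C_def)
    show "g v $ k = 0" if "k \<notin> b ` C" for v k
      using that by (simp add: g_def)
    show "axis k 1 \<in> g ` V" if k: "k \<in> b ` C" for k
    proof -
      from k obtain c where "c \<in> C" "k = b c" by blast
      then show ?thesis using gC[of c] CV by (intro image_eqI[of _ _ c]) auto
    qed
    \<comment> \<open>Parseval's identity for the orthonormal basis \<open>C\<close>.\<close>
    show "norm (g v) = norm v" if "v \<in> V" for v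
    proof -
      have "v = (\<Sum>c\<in>C. (v \<bullet> c) *\<^sub>R c)"
        using orthonormal_basis_expand[OF orth unit VC[OF that] fin] by simp
      then have "v \<bullet> v = v \<bullet> (\<Sum>c\<in>C. (v \<bullet> c) *\<^sub>R c)" by simp
      also have "\<dots> = (\<Sum>c\<in>C. (v \<bullet> c) * (v \<bullet> c))" by (simp add: inner_sum_right)
      also have "\<dots> = (\<Sum>c\<in>C. g v $ b c * g v $ b c)"
        by (rule sum.cong) (auto simp: g_def hb)
      also have "\<dots> = (\<Sum>k\<in>b ` C. g v $ k * g v $ k)"
        using b by (simp add: sum.reindex)
      also have "\<dots> = (\<Sum>k\<in>UNIV. g v $ k * g v $ k)"
        by (rule sum.mono_neutral_left) (auto simp: g_def)
      also have "\<dots> = g v \<bullet> g v" by (simp add: inner_vec_def)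
      finally show ?thesis by (simp add: norm_eq_sqrt_inner)
    qed
  qed
qed

lemma span_axes_supported:
  fixes v :: "real^'d"
  assumes "\<And>k. k \<notin> R \<Longrightarrow> v $ k = 0"
  shows "v \<in> span ((\<lambda>k. axis k 1) ` R)"
proof -
  have "v = (\<Sum>k\<in>R. v $ k *\<^sub>R axis k 1)"
    using assms by (auto simp: vec_eq_iff axis_def if_distrib sum.delta' cong: if_cong)
  also have "\<dots> \<in> span ((\<lambda>k. axis k 1) ` R)"
    by (intro span_sum span_scale span_base imageI)
  finally show ?thesis .
qed

text \<open>Extend \<open>v\<close> to a basis chosen from \<open>W\<close> and index it by
  \<open>R\<close> with \<open>v\<close> at \<open>r\<close>. Later \<open>W\<close> holds the
  vectors of the out-neighbours of a node, so this selects the weights to displace.\<close>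

lemma complete_to_nonsingular:
  fixes v :: "real^'d" and W :: "(real^'d) set"
  assumes v: "v \<noteq> 0" and supp: "\<And>w k. w \<in> insert v W \<Longrightarrow> k \<notin> R \<Longrightarrow> w $ k = 0"
    and span: "\<And>k. k \<in> R \<Longrightarrow> axis k 1 \<in> span (insert v W)" and r: "r \<in> R"
  obtains \<beta> :: "'d \<Rightarrow> real^'d" where "\<beta> r = v" "inj_on \<beta> R" "\<And>k. k \<in> R - {r} \<Longrightarrow> \<beta> k \<in> W"
    "det (\<chi> k. if k \<in> R then \<beta> k else axis k 1) \<noteq> 0"
proof -
  let ?ax = "\<lambda>k. axis k 1 :: real^'d"
  have "independent {v}" using v by simp
  then obtain B where B: "{v} \<subseteq> B" "B \<subseteq> insert v W" "independent B" "insert v W \<subseteq> span B"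
    using maximal_independent_subset_extend[of "{v}" "insert v W"] by auto
  have axB: "?ax k \<in> span B" if "k \<in> R" for k
    using span[OF that] B(4) by (meson span_minimal subsetD subspace_span)
  have inj: "inj_on ?ax R" by (auto simp: inj_on_def axis_eq_axis)
  have "independent (?ax ` R)"
    by (rule independent_mono[OF independent_Basis]) (auto simp: axis_in_Basis_iff)
  \<comment> \<open>\<open>B\<close> and the axes in \<open>R\<close> are bases of the same space,
    so they have equally many elements.\<close>
  then have "card (?ax ` R) = dim (span B)"
  proof (intro basis_card_eq_dim)
    have "B \<subseteq> span (?ax ` R)"
      using supp B(2) span_axes_supported[of R] by blast
    then show "span B \<subseteq> span (?ax ` R)" by (simp add: span_minimal)
  qed (use axB in auto)
  then have card: "card B = card R"
    using B(3) inj by (simp add: card_image dim_eq_card_independent)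
  have fin: "finite B" using B(3) by (rule independent_imp_finite)
  have "card (R - {r}) = card (B - {v})"
    using card r B(1) fin by simp
  then obtain h where h: "bij_betw h (R - {r}) (B - {v})"
    using fin finite_same_card_bij[of "R - {r}" "B - {v}"] by auto
  define \<beta> where "\<beta> = h(r := v)"
  have im: "\<beta> ` R = B"
    using h r B(1) by (auto simp: \<beta>_def bij_betw_def)
  have inj\<beta>: "inj_on \<beta> R"
    using im card by (intro eq_card_imp_inj_on) auto
  let ?M = "\<chi> k. if k \<in> R then \<beta> k else axis k 1"
  have rows: "rows ?M = range (\<lambda>k. if k \<in> R then \<beta> k else axis k 1)"
    by (auto simp: rows_def row_def vec_nth_inverse)
  have "B \<subseteq> rows ?M"
    unfolding rows im[symmetric] by auto
  then have "?ax k \<in> span (rows ?M)" for k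
  proof (cases "k \<in> R")
    case True
    then show ?thesis using axB span_mono[OF \<open>B \<subseteq> rows ?M\<close>] by blast
  next
    case False
    then have "?ax k \<in> rows ?M" unfolding rows by (auto intro!: image_eqI[of _ _ k])
    then show ?thesis by (rule span_base)
  qed
  then have "Basis \<subseteq> span (rows ?M)"
    by (auto simp: Basis_vec_def)
  then have "span (rows ?M) = UNIV"
    using span_minimal[of Basis "span (rows ?M)"] by auto
  then have "det ?M \<noteq> 0"
    by (simp only: invertible_det_nz[symmetric] invertible_left_inverse matrix_left_invertible_span_rows)
  moreover have "\<beta> k \<in> W" if "k \<in> R - {r}" for k
  proof -
    have "\<beta> k \<in> B - {v}"
      using that bij_betwE[OF h] by (auto simp: \<beta>_def)
    then show ?thesis using B(2) by blast
  qed
  ultimately show ?thesis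
    using that[of \<beta>] inj\<beta> by (simp add: \<beta>_def)
qed

text \<open>In the plane a single out-neighbour that is not aligned with a node already completes a basis;
  following edges, every node is aligned with a node that has such an out-neighbour.\<close>
lemma spanning_representative_planar:
  fixes x :: "'n \<Rightarrow> real^'d"
  assumes E: "strongly_connected E" and d: "CARD('d) = 2"
    and unit: "\<And>i. norm (x i) = 1" and dim: "dim (range x) \<ge> 2"
  shows "\<exists>s. (x i = x s \<or> x i = - x s) \<and> range x \<subseteq> span (insert (x s) (x ` {j. (s, j) \<in> E}))"
proof (rule ccontr)
  assume none: "\<not> ?thesis"
  \<comment> \<open>Without such a node, induction along a path from \<open>i\<close> never leaves
    the line of \<open>x i\<close>, contradicting \<open>dim\<close>.\<close>
  have "x j \<in> span {x i}" for j
  proof -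
    have "(i, j) \<in> E\<^sup>*" using E by (simp add: strongly_connected_def)
    then show ?thesis
    proof (induction rule: rtrancl_induct)
      case base
      show ?case by (simp add: span_base)
    next
      case (step s j)
      have al: "x s = x i \<or> x s = - x i"
        using unit_in_span_singleton[OF unit unit step.IH] .
      then have "x i = x s \<or> x i = - x s" by auto
      with none have nspan: "\<not> range x \<subseteq> span (insert (x s) (x ` {j. (s, j) \<in> E}))" by blast
      have "x j \<in> span {x s}"
      proof (rule ccontr)
        assume n: "x j \<notin> span {x s}"
        have nz: "x s \<noteq> 0" using unit[of s] by auto
        have ind: "independent {x j, x s}"
          using n nz by (simp add: independent_insert)
        have "x j \<noteq> x s" using n by (auto simp: span_base)
        then have "card {x j, x s} = 2" by simp
        then have "DIM(real^'d) \<le> card {x j, x s}" using d by simp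
        \<comment> \<open>Two independent vectors span the plane, so \<open>s\<close> would be a
          representative of \<open>i\<close>.\<close>
        then have "UNIV \<subseteq> span {x j, x s}"
          using ind by (intro card_ge_dim_independent) auto
        moreover have "span {x j, x s} \<subseteq> span (insert (x s) (x ` {j. (s, j) \<in> E}))"
          using step.hyps by (intro span_mono) auto
        ultimately show False using nspan by blast
      qed
      moreover have "span {x s} \<subseteq> span {x i}"
        using step.IH by (simp add: span_minimal)
      ultimately show ?case by blast
    qed
  qed
  then have "range x \<subseteq> span {x i}" by blast
  then have "dim (range x) \<le> card {x i}" by (intro dim_le_card) auto
  with dim show False by simp
qed

section \<open>Covering the matrices that have a fixed point of higher rank\<close>

text \<open>Supplies the discrete data for \<open>weights_cover\<close> after rotating the
  configuration. These data range over finite types, so finitely many images cover all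
  cases.\<close>

lemma higher_rank_cover:
  fixes x :: "'n::finite \<Rightarrow> real^'d" and A :: "real^'n^'n"
  assumes eq: "\<And>s. (\<Sum>j\<in>UNIV. A $ s $ j *\<^sub>R x j) = lam s *\<^sub>R x s"
    and A: "\<And>i j. i \<noteq> j \<Longrightarrow> (i, j) \<notin> E \<Longrightarrow> A $ i $ j = 0"
    and unit: "\<And>i. norm (x i) = 1" and dim: "dim (range x) \<ge> 2"
    and rep: "\<And>i. \<exists>s. (x i = x s \<or> x i = - x s) \<and>
                  range x \<subseteq> span (insert (x s) (x ` {j. (s, j) \<in> E}))"
    and T0: "\<And>i j. i = j \<or> (i, j) \<in> E \<Longrightarrow> T0 $ (i, j) = A $ i $ j"
  shows "\<exists>(R :: 'd set) \<kappa> \<iota> \<rho> \<sigma> p.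
    T0 \<in> slots.weights E R \<kappa> \<iota> \<rho> \<sigma> ` {T \<in> slots.regular R \<kappa> \<iota> \<rho> \<sigma>. T $ p = 0}"
proof -
  obtain \<rho> where \<rho>: "\<And>i. x i = x (\<rho> i) \<or> x i = - x (\<rho> i)"
      "\<And>i. range x \<subseteq> span (insert (x (\<rho> i)) (x ` {j. (\<rho> i, j) \<in> E}))"
    using rep by metis
  \<comment> \<open>Any representative can be placed on an axis.\<close>
  define s0 where "s0 = \<rho> undefined"
  have s0: "s0 \<in> range \<rho>" by (simp add: s0_def)
  have "x s0 \<in> span (range x)" by (simp add: span_base)
  then obtain g :: "real^'d \<Rightarrow> real^'d" and R k0 where
    g: "linear g" "k0 \<in> R" "card R = dim (span (range x))" "g (x s0) = axis k0 1"
    and iso: "\<And>v. v \<in> span (range x) \<Longrightarrow> norm (g v) = norm v"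
    and supp: "\<And>v k. k \<notin> R \<Longrightarrow> g v $ k = 0"
    and axes: "\<And>k. k \<in> R \<Longrightarrow> axis k 1 \<in> g ` span (range x)"
    using isometric_coordinates[of "span (range x)" "x s0"] unit subspace_span by metis
  define y where "y i = g (x i)" for i
  have y0: "y s0 = axis k0 1" by (simp add: y_def g)
  have yunit: "norm (y i) = 1" for i
    using iso[of "x i"] unit by (simp add: y_def span_base)
  have ynz: "y i \<noteq> 0" for i
    using yunit[of i] by auto
  have ysupp: "y i $ k = 0" if "k \<notin> R" for i k
    using supp that by (simp add: y_def)
  \<comment> \<open>\<open>R\<close> has at least two elements; a second index \<open>k1\<close>
    gives the coordinate of \<open>y s0\<close> that vanishes.\<close>
  have "R - {k0} \<noteq> {}"
  proof
    assume "R - {k0} = {}"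
    then have "R \<subseteq> {k0}" by blast
    then have "card R \<le> 1" using card_mono[of "{k0}" R] by simp
    with g(3) dim show False by simp
  qed
  then obtain k1 where k1: "k1 \<in> R - {k0}" by blast
  define \<kappa> where "\<kappa> s = (if s = s0 then k0 else SOME k. y s $ k \<noteq> 0)" for s
  have \<kappa>nz: "y s $ \<kappa> s \<noteq> 0" for s
  proof (cases "s = s0")
    case True
    then show ?thesis by (simp add: \<kappa>_def y0)
  next
    case False
    have "\<exists>k. y s $ k \<noteq> 0" using ynz[of s] by (simp add: vec_eq_iff)
    from someI_ex[OF this] False show ?thesis by (simp add: \<kappa>_def)
  qed
  then have \<kappa>R: "\<kappa> s \<in> R" for s
    using ysupp by blast
  define Out where "Out s = {j. (s, j) \<in> E}" for s
  define good where "good s b \<longleftrightarrow> b (\<kappa> s) = y s \<and> inj_on b R \<and> (\<forall>k\<in>R - {\<kappa> s}. b k \<in> y ` Out s) \<and>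
      det (\<chi> k. if k \<in> R then b k else axis k 1) \<noteq> 0" for s and b :: "'d \<Rightarrow> real^'d"
  have ex: "\<exists>b. good s b" if s: "s \<in> range \<rho>" for s
  proof -
    have sp: "axis k 1 \<in> span (insert (y s) (y ` Out s))" if "k \<in> R" for k
    proof -
      from s obtain i where i: "s = \<rho> i" by blast
      have "span (range x) \<subseteq> span (insert (x s) (x ` Out s))"
        using \<rho>(2)[of i] by (simp add: span_minimal i Out_def)
      then have "axis k 1 \<in> g ` span (insert (x s) (x ` Out s))"
        using axes[OF that] by blast
      also have "\<dots> = span (insert (y s) (y ` Out s))"
        by (simp add: linear_span_image[OF g(1), symmetric] y_def image_image)
      finally show ?thesis .
    qed
    have su: "w $ k = 0" if "w \<in> insert (y s) (y ` Out s)" "k \<notin> R" for w k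
      using that ysupp by auto
    show ?thesis
    proof (rule complete_to_nonsingular[OF ynz su sp \<kappa>R[of s]])
      fix \<beta> :: "'d \<Rightarrow> real^'d"
      assume "\<beta> (\<kappa> s) = y s" "inj_on \<beta> R" "\<And>k. k \<in> R - {\<kappa> s} \<Longrightarrow> \<beta> k \<in> y ` Out s"
        "det (\<chi> k. if k \<in> R then \<beta> k else axis k 1) \<noteq> 0"
      then show ?thesis unfolding good_def by (intro exI[of _ \<beta>] conjI ballI)
    qed
  qed
  define \<beta> where "\<beta> s = (SOME b. good s b)" for s
  have good: "good s (\<beta> s)" if "s \<in> range \<rho>" for s
    unfolding \<beta>_def by (rule someI_ex[OF ex[OF that]])
  have \<beta>: "\<beta> s (\<kappa> s) = y s" "inj_on (\<beta> s) R"
      "\<And>k. k \<in> R - {\<kappa> s} \<Longrightarrow> \<beta> s k \<in> y ` Out s"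
      "det (\<chi> k. if k \<in> R then \<beta> s k else axis k 1) \<noteq> 0" if "s \<in> range \<rho>" for s
    using good[OF that] unfolding good_def by simp_all
  define \<iota> where "\<iota> s k = (SOME j. j \<in> Out s \<and> y j = \<beta> s k)" for s k
  have \<iota>: "\<iota> s k \<in> Out s" "y (\<iota> s k) = \<beta> s k" if "s \<in> range \<rho>" "k \<in> R - {\<kappa> s}" for s k
  proof -
    have "\<exists>j. j \<in> Out s \<and> y j = \<beta> s k"
      using \<beta>(3)[OF that] by auto
    from someI_ex[OF this] show "\<iota> s k \<in> Out s" "y (\<iota> s k) = \<beta> s k"
      by (simp_all add: \<iota>_def)
  qed
  \<comment> \<open>Records whether \<open>y i\<close> is the unit vector recovered from the chart
    of its representative or the opposite one.\<close>
  define \<sigma> where "\<sigma> i \<longleftrightarrow> y i = sgn (y (\<rho> i) $ \<kappa> (\<rho> i)) *\<^sub>R y (\<rho> i)" for i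
  have "T0 \<in> slots.weights E R \<kappa> \<iota> \<rho> \<sigma> ` {T \<in> slots.regular R \<kappa> \<iota> \<rho> \<sigma>. T $ (s0, \<iota> s0 k1) = 0}"
  proof (rule slots.weights_cover[where x = y and A = A and lam = lam])
    \<comment> \<open>Row equations survive a linear map with the same weights and
      multipliers.\<close>
    show "(\<Sum>j\<in>UNIV. A $ s $ j *\<^sub>R y j) = lam s *\<^sub>R y s" for s
      using arg_cong[OF eq[of s], of g] by (simp add: y_def linear_sum[OF g(1)] linear_scale[OF g(1)])
    show "y i = (if \<sigma> i then 1 else - 1) *\<^sub>R (sgn (y (\<rho> i) $ \<kappa> (\<rho> i)) *\<^sub>R y (\<rho> i))" for i
    proof -
      have "y i = y (\<rho> i) \<or> y i = - y (\<rho> i)"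
        using \<rho>(1)[of i] by (auto simp: y_def linear_neg[OF g(1)])
      then show ?thesis
        using \<kappa>nz[of "\<rho> i"] by (auto simp: \<sigma>_def sgn_real_def)
    qed
    show "\<kappa> s \<in> R \<and> y s $ \<kappa> s \<noteq> 0" for s
      using \<kappa>R \<kappa>nz by simp
    show "inj_on (\<iota> s) (R - {\<kappa> s})" if s: "s \<in> range \<rho>" for s
    proof (rule inj_onI)
      fix k l assume kl: "k \<in> R - {\<kappa> s}" "l \<in> R - {\<kappa> s}" "\<iota> s k = \<iota> s l"
      then have "\<beta> s k = \<beta> s l"
        using \<iota>(2)[OF s] by metis
      then show "k = l"
        using \<beta>(2)[OF s] kl by (simp add: inj_on_eq_iff)
    qed
    show "\<iota> s k \<noteq> s \<and> (s, \<iota> s k) \<in> E" if s: "s \<in> range \<rho>" and k: "k \<in> R - {\<kappa> s}" for s k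
    proof -
      \<comment> \<open>\<open>E\<close> may contain self-loops, so
        \<open>\<iota> s k \<noteq> s\<close> comes from the injectivity of
        \<open>\<beta> s\<close>.\<close>
      have "\<beta> s k \<noteq> \<beta> s (\<kappa> s)"
        using k \<kappa>R[of s] \<beta>(2)[OF s] by (auto simp: inj_on_eq_iff)
      then have "y (\<iota> s k) \<noteq> y s"
        using \<iota>(2)[OF s k] \<beta>(1)[OF s] by simp
      then show ?thesis
        using \<iota>(1)[OF s k] by (auto simp: Out_def)
    qed
    show "det (slots.system R \<kappa> \<iota> y s) \<noteq> 0" if s: "s \<in> range \<rho>" for s
    proof -
      have "slots.system R \<kappa> \<iota> y s = (\<chi> k. if k \<in> R then \<beta> s k else axis k 1)"
        using \<iota>(2)[OF s] \<beta>(1)[OF s] \<kappa>R[of s] by (auto simp: slots.system_def vec_eq_iff)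
      then show ?thesis using \<beta>(4)[OF s] by simp
    qed
    show "k1 \<in> R - {\<kappa> s0}" using k1 by (simp add: \<kappa>_def)
    show "y s0 $ k1 = 0" using k1 by (simp add: y0 axis_def)
  qed (fact A yunit ysupp T0 s0)+
  then show ?thesis by blast
qed

section \<open>Nullity of the set of exceptional matrices\<close>

theorem theorem2:
  fixes E :: "('n::finite \<times> 'n) set"
  assumes "CARD('d::finite) \<ge> 2"
    and "strongly_connected E"
    and "(CARD('d) = 2 \<and> strongly_connected E) \<or> (CARD('d) \<ge> 2 \<and> complete_graph E)"
  shows "measure_zero_in_weights E
           {A \<in> dominant_weights E. fixed_points A \<noteq> (consensus_or_antipodal :: (real^'d^'n) set)}"
proof -
  let ?bad = "{A \<in> dominant_weights E. fixed_points A \<noteq> (consensus_or_antipodal :: (real^'d^'n) set)}"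
  let ?I = "free_positions E"
  define N :: "(real^('n \<times> 'n)) set" where
    "N = (\<Union>R :: 'd set. \<Union>\<kappa> \<iota> \<rho> \<sigma> p.
       slots.weights E R \<kappa> \<iota> \<rho> \<sigma> ` {T \<in> slots.regular R \<kappa> \<iota> \<rho> \<sigma>. T $ p = 0})"
  have negl: "negligible N"
    unfolding N_def
    by (auto intro!: negligible_Union slots.negligible_weights_gauge)
  \<comment> \<open>\<open>N\<close> lives in all matrix positions, the exceptional set only in the
    free ones; \<open>N\<close> contains the whole cylinder over it.\<close>
  have "coords E ` ?bad \<in> null_sets (completion (\<Pi>\<^sub>M p\<in>?I. lborel))"
  proof (rule null_sets_completion_slice[OF negl])
    show "coords E ` ?bad \<subseteq> space (\<Pi>\<^sub>M p\<in>?I. lborel)"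
      by (auto simp: coords_def space_PiM)
    fix h T assume h: "h \<in> coords E ` ?bad" and T: "\<And>p. p \<in> ?I \<Longrightarrow> T $ p = h p"
    from h obtain A where A: "A \<in> dominant_weights E" and hA: "h = coords E A"
      and "fixed_points A \<noteq> (consensus_or_antipodal :: (real^'d^'n) set)" by blast
    then obtain X :: "real^'d^'n" where X: "X \<in> fixed_points A" "X \<notin> consensus_or_antipodal"
      using consensus_subset_fixed_points[OF A] by blast
    let ?x = "($) X"
    have sp: "X \<in> sphere_product" using X(1) by (simp add: fixed_points_def)
    then have unit: "norm (?x i) = 1" for i by (simp add: sphere_product_def)
    have "rank X \<noteq> 1" using X(2) sp by (simp add: consensus_or_antipodal_def)
    moreover have "X \<noteq> 0" using unit[of undefined] by auto
    then have "rank X \<noteq> 0" by (simp add: rank_eq_0)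
    ultimately have "rank X \<ge> 2"
      by linarith
    then have dim: "dim (range ?x) \<ge> 2"
      by (simp only: rank_eq_dim_range)
    have rep: "\<exists>s. (?x i = ?x s \<or> ?x i = - ?x s) \<and>
        range ?x \<subseteq> span (insert (?x s) (?x ` {j. (s, j) \<in> E}))" for i
      using assms(3)
    proof
      assume "CARD('d) = 2 \<and> strongly_connected E"
      then show ?thesis
        using spanning_representative_planar[of E ?x i] unit dim by blast
    next
      assume "CARD('d) \<ge> 2 \<and> complete_graph E"
      \<comment> \<open>In a complete graph all other nodes are out-neighbours, so every node
        represents itself.\<close>
      then have "?x j \<in> insert (?x i) (?x ` {j. (i, j) \<in> E})" for j
        by (cases "j = i") (auto simp: complete_graph_def)
      then show ?thesis
        using span_superset[of "insert (?x i) (?x ` {j. (i, j) \<in> E})"]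
        by (intro exI[of _ i] conjI disjI1 refl) blast
    qed
    have "T $ (i, j) = A $ i $ j" if "i = j \<or> (i, j) \<in> E" for i j
      using T[of "(i, j)"] that by (simp add: hA coords_def free_positions_def)
    from higher_rank_cover[OF fixed_points_row[OF X(1)] dominant_weightsD(2)[OF A] unit dim rep this]
    show "T \<in> N" by (auto simp: N_def)
  qed
  then show ?thesis
    by (auto simp: measure_zero_in_weights_def coord_measure_def)
qed

end
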